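(* The cylinder $Cyl^p=([0,1]\times S^1,\tau^p)$ is a bounded Lorentzian metric space for every $p\in[1,\infty)$, but $Cyl^\infty$ is not a bounded Lorentzian metric space.
   Context: $S^1=\mathbb{R}/2\pi\mathbb{Z}$, with arc-length distance $\delta(\alpha,\beta)\in[0,\pi]$. $Cyl^p$ is the set $[0,1]\times S^1$ (first coordinate is time) with the time separation function induced from the plane: for $1\le p<\infty$, $$\tau^p((s,\alpha),(t,\beta))=\big((t-s)^p-\delta(\alpha,\beta)^p\big)^{1/p}\ \text{ if } t-s\ge\delta(\alpha,\beta),\qquad \tau^p=0\ \text{ otherwise},$$ and $\tau^\infty$ is the pointwise limit as $p\to\infty$: $\tau^\infty((s,\alpha),(t,\beta))=t-s$ if $t-s>\delta(\alpha,\beta)$, and $0$ otherwise. A bounded Lorentzian metric space $(X,\tau)$ is a set $X$ with a function $\tau:X\times X\to[0,\infty)$ such that: (i) $\tau(x,z)\ge\tau(x,y)+\tau(y,z)$ for all $x,y,z\in X$ with $\tau(x,y)>0$ and $\tau(y,z)>0$; (ii) $\tau$ distinguishes points: for all $x\ne y$ in $X$ there is $z\in X$ with $\tau(x,z)\ne\tau(y,z)$ or $\tau(z,x)\ne\tau(z,y)$; (iii) there exists a topology $T$ on $X$ such that $\tau:X\times X\to\mathbb{R}$ is continuous (product topology) and for every $\epsilon>0$ the set $\{(x,y)\in X\times X:\tau(x,y)\ge\epsilon\}$ is compact. *)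

theory Defs
  imports "HOL-Analysis.Analysis"
begin

definition circle_rel :: "real \<Rightarrow> real \<Rightarrow> bool" where
  "circle_rel a b \<longleftrightarrow> (\<exists>k::int. a - b = 2 * pi * of_int k)"

lemma equivp_circle_rel: "equivp circle_rel"
proof (rule equivpI)
  show "reflp circle_rel"
    unfolding circle_rel_def by (rule reflpI) (auto intro: exI[of _ 0])
  show "symp circle_rel"
  proof (rule sympI)
    fix a b assume "circle_rel a b"
    then obtain k :: int where "a - b = 2 * pi * of_int k" by (auto simp: circle_rel_def)
    then have "b - a = 2 * pi * of_int (- k)" by simp
    then show "circle_rel b a" unfolding circle_rel_def by blast
  qed
  show "transp circle_rel"
  proof (rule transpI)
    fix a b c assume "circle_rel a b" "circle_rel b c"
    then obtain k l :: int where "a - b = 2 * pi * of_int k" "b - c = 2 * pi * of_int l"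
      by (auto simp: circle_rel_def)
    then have "a - c = 2 * pi * of_int (k + l)" by (simp add: algebra_simps)
    then show "circle_rel a c" unfolding circle_rel_def by blast
  qed
qed

quotient_type circle = real / circle_rel
  by (rule equivp_circle_rel)

text \<open>Arc-length distance: the quotient distance, i.e. the least distance between representatives.\<close>

lift_definition arc_dist :: "circle \<Rightarrow> circle \<Rightarrow> real" is
  "\<lambda>a b. INF k::int. \<bar>a - b + 2 * pi * of_int k\<bar>"
proof -
  fix a a' b b' assume "circle_rel a a'" "circle_rel b b'"
  then obtain k l :: int where k: "a - a' = 2 * pi * of_int k" and l: "b - b' = 2 * pi * of_int l"
    by (auto simp: circle_rel_def)
  have eq: "\<bar>a - b + 2 * pi * of_int m\<bar> = \<bar>a' - b' + 2 * pi * of_int (m + (k - l))\<bar>" for m :: int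
  proof -
    have "a - b + 2 * pi * of_int m = a' - b' + 2 * pi * of_int (m + (k - l))"
      using k l by (simp add: algebra_simps)
    then show ?thesis by simp
  qed
  have "range (\<lambda>m::int. \<bar>a - b + 2 * pi * of_int m\<bar>)
      = (\<lambda>m. \<bar>a' - b' + 2 * pi * of_int m\<bar>) ` range (\<lambda>m. m + (k - l))"
    by (simp only: eq image_image)
  also have "range (\<lambda>m. m + (k - l)) = UNIV"
    by (rule surjI[of _ "\<lambda>m. m - (k - l)"]) simp
  finally show "(INF m::int. \<bar>a - b + 2 * pi * of_int m\<bar>)
      = (INF m::int. \<bar>a' - b' + 2 * pi * of_int m\<bar>)"
    by simp
qed

lemma arc_dist_nonneg: "0 \<le> arc_dist \<alpha> \<beta>"
  by transfer (rule cINF_greatest, auto)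

lemma arc_dist_le_pi: "arc_dist \<alpha> \<beta> \<le> pi"
proof transfer
  fix a b :: real
  define k where "k = - round ((a - b) / (2 * pi))"
  have "\<bar>of_int (round ((a - b) / (2 * pi))) - (a - b) / (2 * pi)\<bar> \<le> 1/2"
    by (rule of_int_round_abs_le)
  then have "\<bar>(a - b) / (2 * pi) + of_int k\<bar> \<le> 1/2"
    unfolding k_def by (simp add: abs_minus_commute)
  then have "(2 * pi) * \<bar>(a - b) / (2 * pi) + of_int k\<bar> \<le> (2 * pi) * (1/2)"
    by (intro mult_left_mono) auto
  moreover have "(2 * pi) * \<bar>(a - b) / (2 * pi) + of_int k\<bar> = \<bar>a - b + 2 * pi * of_int k\<bar>"
  proof -
    have "a - b + 2 * pi * of_int k = (2 * pi) * ((a - b) / (2 * pi) + of_int k)"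
      by (simp add: field_simps)
    then show ?thesis by (simp only: abs_mult) simp
  qed
  ultimately have "\<bar>a - b + 2 * pi * of_int k\<bar> \<le> pi" by simp
  moreover have "(INF k::int. \<bar>a - b + 2 * pi * of_int k\<bar>) \<le> \<bar>a - b + 2 * pi * of_int k\<bar>"
    by (rule cINF_lower) (auto intro: bdd_belowI[of _ 0])
  ultimately show "(INF k::int. \<bar>a - b + 2 * pi * of_int k\<bar>) \<le> pi" by linarith
qed

definition cyl :: "(real \<times> circle) set" where
  "cyl = {0..1} \<times> UNIV"

definition cyl_tau :: "real \<Rightarrow> real \<times> circle \<Rightarrow> real \<times> circle \<Rightarrow> real" where
  "cyl_tau p = (\<lambda>(s, \<alpha>) (t, \<beta>).
     if t - s \<ge> arc_dist \<alpha> \<beta>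
     then ((t - s) powr p - arc_dist \<alpha> \<beta> powr p) powr (1 / p) else 0)"

definition cyl_tau_inf :: "real \<times> circle \<Rightarrow> real \<times> circle \<Rightarrow> real" where
  "cyl_tau_inf = (\<lambda>(s, \<alpha>) (t, \<beta>). if t - s > arc_dist \<alpha> \<beta> then t - s else 0)"

lemma cyl_tau_tendsto_cyl_tau_inf: "((\<lambda>p. cyl_tau p x y) \<longlongrightarrow> cyl_tau_inf x y) at_top"
proof -
  obtain s \<alpha> t \<beta> where xy: "x = (s, \<alpha>)" "y = (t, \<beta>)" by (cases x, cases y)
  define d where "d = arc_dist \<alpha> \<beta>"
  define u where "u = t - s"
  have d0: "0 \<le> d" by (simp add: d_def arc_dist_nonneg)
  show ?thesis
  proof (cases "d < u")
    case False
    then have "cyl_tau p x y = 0" for p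
      by (auto simp: xy cyl_tau_def d_def u_def)
    then show ?thesis using False by (simp add: xy cyl_tau_inf_def d_def u_def)
  next
    case du: True
    then have u0: "0 < u" using d0 by simp
    define r where "r = d / u"
    have r: "0 \<le> r" "r < 1" using d0 du u0 by (auto simp: r_def)
    have eq: "cyl_tau p x y = u * (1 - r powr p) powr (1 / p)" if "p \<ge> 1" for p
    proof -
      have "r powr p \<le> 1" using r that by (intro powr_le1) auto
      have "u powr p - d powr p = u powr p * (1 - r powr p)"
        using u0 d0 by (simp add: r_def powr_divide right_diff_distrib)
      then have "(u powr p - d powr p) powr (1/p) = (u powr p) powr (1/p) * (1 - r powr p) powr (1/p)"
        using \<open>r powr p \<le> 1\<close> u0 by (simp add: powr_mult)
      also have "(u powr p) powr (1/p) = u" using u0 that by (simp add: powr_powr)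
      finally show ?thesis using du by (simp add: xy cyl_tau_def flip: d_def u_def)
    qed
    have "((\<lambda>p. u * (1 - r) powr (1 / p)) \<longlongrightarrow> u * (1 - r) powr 0) at_top"
      using r by (intro tendsto_intros tendsto_powr)
        (auto intro!: tendsto_divide_0[OF tendsto_const] filterlim_at_top_imp_at_infinity filterlim_ident)
    then have lo: "((\<lambda>p. u * (1 - r) powr (1 / p)) \<longlongrightarrow> u) at_top"
      using r by simp
    have rp: "r powr p \<le> r" if "p \<ge> 1" for p
      using powr_mono'[of 1 p r] r that by (cases "r = 0") auto
    have "((\<lambda>p. u * (1 - r powr p) powr (1 / p)) \<longlongrightarrow> u) at_top"
    proof (rule tendsto_sandwich[OF _ _ lo tendsto_const])
      show "\<forall>\<^sub>F p in at_top. u * (1 - r) powr (1 / p) \<le> u * (1 - r powr p) powr (1 / p)"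
        using eventually_ge_at_top[of 1]
        by eventually_elim (use rp r u0 in \<open>auto intro!: mult_left_mono powr_mono2\<close>)
      show "\<forall>\<^sub>F p in at_top. u * (1 - r powr p) powr (1 / p) \<le> u"
        using eventually_ge_at_top[of 1]
      proof eventually_elim
        case (elim p)
        have "(1 - r powr p) powr (1/p) \<le> 1"
          using rp[OF elim] r elim by (intro powr_le1) auto
        then show ?case using u0 by simp
      qed
    qed
    moreover have "\<forall>\<^sub>F p in at_top. cyl_tau p x y = u * (1 - r powr p) powr (1 / p)"
      using eventually_ge_at_top[of 1] by eventually_elim (rule eq)
    ultimately have "((\<lambda>p. cyl_tau p x y) \<longlongrightarrow> u) at_top"
      by (simp add: tendsto_cong)
    then show ?thesis using du by (simp add: xy cyl_tau_inf_def flip: d_def u_def)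
  qed
qed

text \<open>The topology \<open>T\<close> is existentially quantified and unrelated to any topology of the
  ambient type; no separation axiom is assumed.\<close>

definition bounded_lorentzian_metric_space :: "'a set \<Rightarrow> ('a \<Rightarrow> 'a \<Rightarrow> real) \<Rightarrow> bool" where
  "bounded_lorentzian_metric_space X \<tau> \<longleftrightarrow>
     (\<forall>x\<in>X. \<forall>y\<in>X. 0 \<le> \<tau> x y) \<and>
     (\<forall>x\<in>X. \<forall>y\<in>X. \<forall>z\<in>X. \<tau> x y > 0 \<and> \<tau> y z > 0 \<longrightarrow> \<tau> x z \<ge> \<tau> x y + \<tau> y z) \<and>
     (\<forall>x\<in>X. \<forall>y\<in>X. x \<noteq> y \<longrightarrow> (\<exists>z\<in>X. \<tau> x z \<noteq> \<tau> y z \<or> \<tau> z x \<noteq> \<tau> z y)) \<and>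
     (\<exists>T. topspace T = X \<and>
        continuous_map (prod_topology T T) euclideanreal (\<lambda>(x, y). \<tau> x y) \<and>
        (\<forall>\<epsilon>>0. compactin (prod_topology T T) {(x, y) \<in> X \<times> X. \<tau> x y \<ge> \<epsilon>}))"

end

theory Submission
  imports Defs
begin

text \<open>
  \<^bold>\<open>Finite exponent.\<close>  Take on the cylinder the product of the usual topology of the interval with
  the metric topology of the arc-length distance.  This space is compact, and \<open>cyl_tau p\<close> is
  continuous on it: the two branches of its definition agree on the light cone, where the formula
  \<open>(u powr p - d powr p) powr (1 / p)\<close> vanishes (lemma \<open>cyl_tau_eq_max\<close> rewrites it without a case
  distinction).  So each set of pairs with separation at least \<open>\<epsilon>\<close> is closed in a compact space.
  The reverse triangle inequality is Minkowski's inequality for the \<open>p\<close>-norm of the plane read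
  backwards (\<open>reverse_minkowski\<close>), combined with the triangle inequality of the circle.  A point
  of the cylinder is recognised by its separations from the two boundary circles: a separation is
  at most the elapsed time, and if time has elapsed, equality holds only at the same angle.

  \<^bold>\<open>Infinite exponent.\<close>  The separation now jumps at the light cone, and the pairs with separation
  at least \<open>1\<close> are exactly those joining the bottom circle to the top circle at angular distance
  strictly below \<open>1\<close>.  Any admissible topology makes chronological pasts and futures open, and
  on this set of pairs they already bound the angular distance away from \<open>1\<close> near each pair.  By
  compactness the distance would be bounded away from \<open>1\<close> on the whole set, whereas it takes every
  value in \<open>[0, 1)\<close> there.
\<close>

section \<open>The arc-length distance as a metric\<close>

lemma abs_circle_eq_iff: "abs_circle a = abs_circle b \<longleftrightarrow> circle_rel a b"
  by (rule circle.abs_eq_iff)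

lemma ex_representative: "\<exists>a. abs_circle a = \<alpha>"
  by (induct \<alpha> rule: circle.abs_induct) blast

lemma abs_circle_shift: "abs_circle (a + 2 * pi * of_int k) = abs_circle a"
  by (auto simp: abs_circle_eq_iff circle_rel_def)

lemma arc_dist_abs_circle_le: "arc_dist (abs_circle a) (abs_circle b) \<le> \<bar>a - b\<bar>"
proof -
  have "(INF k::int. \<bar>a - b + 2 * pi * of_int k\<bar>) \<le> \<bar>a - b + 2 * pi * of_int 0\<bar>"
    by (rule cINF_lower) (auto intro: bdd_belowI[of _ 0])
  then show ?thesis
    by (simp add: arc_dist.abs_eq)
qed

lemma arc_dist_abs_circle:
  assumes "\<bar>a - b\<bar> \<le> pi"
  shows "arc_dist (abs_circle a) (abs_circle b) = \<bar>a - b\<bar>"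
proof (rule antisym[OF arc_dist_abs_circle_le])
  have "\<bar>a - b\<bar> \<le> \<bar>a - b + 2 * pi * of_int k\<bar>" for k :: int
  proof (cases "k = 0")
    case False
    then have "1 \<le> \<bar>real_of_int k\<bar>"
      by linarith
    then have "2 * pi * 1 \<le> 2 * pi * \<bar>real_of_int k\<bar>"
      by (intro mult_left_mono) auto
    also have "\<dots> = \<bar>2 * pi * real_of_int k\<bar>"
      by (simp add: abs_mult)
    finally show ?thesis
      using assms by linarith
  qed simp
  then show "\<bar>a - b\<bar> \<le> arc_dist (abs_circle a) (abs_circle b)"
    unfolding arc_dist.abs_eq by (intro cINF_greatest) auto
qed

text \<open>
  A minimising representative: one end of a shortest arc can be lifted to any prescribed real
  number.  This reduces statements about the infimum in \<open>arc_dist\<close> to the absolute value on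
  the line.
\<close>

lemma nearest_representative:
  obtains a where "abs_circle a = \<alpha>" "\<bar>a - b\<bar> \<le> pi" "arc_dist \<alpha> (abs_circle b) = \<bar>a - b\<bar>"
proof -
  obtain c where c: "abs_circle c = \<alpha>"
    using ex_representative by blast
  define k where "k = - round ((c - b) / (2 * pi))"
  define a where "a = c + 2 * pi * of_int k"
  have "\<bar>of_int (round ((c - b) / (2 * pi))) - (c - b) / (2 * pi)\<bar> \<le> 1 / 2"
    by (rule of_int_round_abs_le)
  then have "\<bar>(c - b) / (2 * pi) + of_int k\<bar> \<le> 1 / 2"
    by (simp add: k_def abs_minus_commute)
  moreover have "a - b = (2 * pi) * ((c - b) / (2 * pi) + of_int k)"
    by (simp add: a_def field_simps)
  ultimately have near: "\<bar>a - b\<bar> \<le> pi"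
    by (simp add: abs_mult)
  have "abs_circle a = \<alpha>"
    by (simp only: a_def abs_circle_shift c)
  then show thesis
    using that near arc_dist_abs_circle[OF near] by metis
qed

lemma arc_dist_commute: "arc_dist \<alpha> \<beta> = arc_dist \<beta> \<alpha>"
proof -
  obtain b where b: "abs_circle b = \<beta>"
    using ex_representative by blast
  obtain a where a: "abs_circle a = \<alpha>" "\<bar>a - b\<bar> \<le> pi"
    by (rule nearest_representative)
  then show ?thesis
    using arc_dist_abs_circle[of a b] arc_dist_abs_circle[of b a] b
    by (simp add: abs_minus_commute)
qed

lemma arc_dist_triangle: "arc_dist \<alpha> \<gamma> \<le> arc_dist \<alpha> \<beta> + arc_dist \<beta> \<gamma>"
proof -
  obtain b where b: "abs_circle b = \<beta>"
    using ex_representative by blast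
  obtain a where a: "abs_circle a = \<alpha>" "arc_dist \<alpha> \<beta> = \<bar>a - b\<bar>"
    using nearest_representative b by metis
  obtain c where c: "abs_circle c = \<gamma>" "arc_dist \<gamma> \<beta> = \<bar>c - b\<bar>"
    using nearest_representative b by metis
  show ?thesis
    using arc_dist_abs_circle_le[of a c] a c arc_dist_commute[of \<gamma> \<beta>] by simp
qed

lemma arc_dist_eq_0_iff: "arc_dist \<alpha> \<beta> = 0 \<longleftrightarrow> \<alpha> = \<beta>"
proof -
  obtain b where b: "abs_circle b = \<beta>"
    using ex_representative by blast
  obtain a where "abs_circle a = \<alpha>" "arc_dist \<alpha> \<beta> = \<bar>a - b\<bar>"
    using nearest_representative b by metis
  then show ?thesis
    using b arc_dist_abs_circle[of b b] by auto
qed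

lemma arc_dist_refl [simp]: "arc_dist \<alpha> \<alpha> = 0"
  by (simp add: arc_dist_eq_0_iff)

interpretation circle: Metric_space UNIV arc_dist
  by unfold_locales
    (simp_all add: arc_dist_nonneg arc_dist_commute arc_dist_eq_0_iff arc_dist_triangle)

lemma continuous_map_arc_dist:
  "continuous_map (prod_topology circle.mtopology circle.mtopology) euclideanreal
     (\<lambda>(\<alpha>, \<beta>). arc_dist \<alpha> \<beta>)"
  using continuous_map_metric[of "metric (UNIV, arc_dist)"] circle.Metric_space_axioms
  by (simp add: mtopology_of_def)

lemma compact_space_circle: "compact_space circle.mtopology"
proof -
  have "continuous_map euclideanreal circle.mtopology abs_circle"
    using Met_TC.metric_continuous_map[OF circle.Metric_space_axioms, of abs_circle]
    by (auto simp: dist_real_def intro: order.strict_trans1[OF arc_dist_abs_circle_le])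
  then have "compactin circle.mtopology (abs_circle ` {- pi..pi})"
    by (intro image_compactin[of euclideanreal]) simp_all
  moreover have "\<alpha> \<in> abs_circle ` {- pi..pi}" for \<alpha>
  proof -
    obtain a where "abs_circle a = \<alpha>" "\<bar>a - 0\<bar> \<le> pi"
      by (rule nearest_representative)
    then show ?thesis
      by (intro image_eqI[of _ _ a]) auto
  qed
  then have "abs_circle ` {- pi..pi} = UNIV"
    by blast
  ultimately show ?thesis
    by (simp add: compact_space_def)
qed

section \<open>Minkowski's inequality read backwards\<close>

text \<open>
  The end point \<open>0\<close> matters because angular distances may vanish.  There, convexity says that
  \<open>t powr p \<le> t\<close> for weights \<open>t\<close> below \<open>1\<close>.
\<close>

lemma convex_on_powr_nonneg:
  fixes p :: real
  assumes "1 \<le> p"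
  shows "convex_on {0..} (\<lambda>x. x powr p)"
proof (rule convex_on_linorderI)
  fix t x y :: real
  assume t: "0 < t" "t < 1" and xy: "x \<in> {0..}" "y \<in> {0..}" "x < y"
  show "((1 - t) *\<^sub>R x + t *\<^sub>R y) powr p \<le> (1 - t) * x powr p + t * y powr p"
  proof (cases "x = 0")
    case True
    have "t powr p \<le> t"
      using powr_mono'[of 1 p t] assms t by simp
    then have "t powr p * y powr p \<le> t * y powr p"
      by (intro mult_right_mono) auto
    then show ?thesis
      using True t xy by (simp add: powr_mult)
  next
    case False
    then show ?thesis
      using convex_onD[OF powr_convex[OF assms], of t x y] t xy by simp
  qed
qed simp

text \<open>
  Convexity at the ratios \<open>a / u\<close> and \<open>b / v\<close>.  When \<open>u\<close> and \<open>v\<close> are the norms of two vectors,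
  adding this estimate over their coordinates gives Minkowski's inequality.
\<close>

lemma powr_add_le_weighted:
  fixes a b u v p :: real
  assumes "1 \<le> p" "0 \<le> a" "0 \<le> b" "0 < u" "0 < v"
  shows "((a + b) / (u + v)) powr p \<le> (u / (u + v)) * (a / u) powr p + (v / (u + v)) * (b / v) powr p"
proof -
  have w: "1 - v / (u + v) = u / (u + v)"
    using assms by (simp add: field_simps)
  have "(a + b) / (u + v) = (1 - v / (u + v)) *\<^sub>R (a / u) + (v / (u + v)) *\<^sub>R (b / v)"
    unfolding w using assms by (simp add: add_divide_distrib)
  also have "\<dots> powr p \<le> (1 - v / (u + v)) * (a / u) powr p + (v / (u + v)) * (b / v) powr p"
    using assms by (intro convex_onD[OF convex_on_powr_nonneg]) auto
  finally show ?thesis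
    by (simp only: w)
qed

lemma reverse_minkowski:
  fixes u v d e p :: real
  assumes p: "1 \<le> p" and d: "0 \<le> d" "d \<le> u" and e: "0 \<le> e" "e \<le> v" and pos: "0 < u" "0 < v"
  shows "(u powr p - d powr p) powr (1 / p) + (v powr p - e powr p) powr (1 / p)
       \<le> ((u + v) powr p - (d + e) powr p) powr (1 / p)"
proof -
  define a where "a = (u powr p - d powr p) powr (1 / p)"
  define b where "b = (v powr p - e powr p) powr (1 / p)"
  \<comment> \<open>By the choice of \<open>a\<close> and \<open>b\<close>, the plane vectors \<open>(a, d)\<close> and \<open>(b, e)\<close> have \<open>p\<close>-norms \<open>u\<close>
    and \<open>v\<close>.\<close>
  have a: "0 \<le> a" "a powr p + d powr p = u powr p"
    using p d by (simp_all add: a_def powr_powr powr_mono2)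
  have b: "0 \<le> b" "b powr p + e powr p = v powr p"
    using p e by (simp_all add: b_def powr_powr powr_mono2)
  have unit: "(a / u) powr p + (d / u) powr p = 1" "(b / v) powr p + (e / v) powr p = 1"
    using a b d e pos by (simp_all add: powr_divide flip: add_divide_distrib)
  have "((a + b) / (u + v)) powr p + ((d + e) / (u + v)) powr p
      \<le> (u / (u + v)) * ((a / u) powr p + (d / u) powr p)
        + (v / (u + v)) * ((b / v) powr p + (e / v) powr p)"
    using powr_add_le_weighted[OF p a(1) b(1) pos] powr_add_le_weighted[OF p d(1) e(1) pos]
    by (simp add: distrib_left)
  also have "\<dots> = 1"
    unfolding unit using pos by (simp flip: add_divide_distrib)
  finally have "(a + b) powr p + (d + e) powr p \<le> (u + v) powr p"
    using a b d e pos by (simp add: powr_divide field_simps)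
  then have "((a + b) powr p) powr (1 / p) \<le> ((u + v) powr p - (d + e) powr p) powr (1 / p)"
    using p by (intro powr_mono2) auto
  then show ?thesis
    using p a b by (simp add: powr_powr a_def[symmetric] b_def[symmetric])
qed

section \<open>The cylinder with finite exponent\<close>

lemma cyl_tau_nonneg: "0 \<le> cyl_tau p x y"
  by (cases x; cases y) (simp add: cyl_tau_def)

lemma cyl_tau_pos_imp:
  assumes "0 < cyl_tau p (s, \<alpha>) (t, \<beta>)"
  shows "arc_dist \<alpha> \<beta> < t - s"
proof (rule ccontr)
  assume "\<not> arc_dist \<alpha> \<beta> < t - s"
  then have "cyl_tau p (s, \<alpha>) (t, \<beta>) = 0"
    by (auto simp: cyl_tau_def)
  with assms show False
    by simp
qed

lemma cyl_tau_reverse_triangle: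
  assumes p: "1 \<le> p" and pos: "0 < cyl_tau p x y" "0 < cyl_tau p y z"
  shows "cyl_tau p x y + cyl_tau p y z \<le> cyl_tau p x z"
proof -
  obtain r \<alpha> s \<beta> t \<gamma> where xyz: "x = (r, \<alpha>)" "y = (s, \<beta>)" "z = (t, \<gamma>)"
    by (cases x, cases y, cases z)
  let ?d = "arc_dist \<alpha> \<beta>" and ?e = "arc_dist \<beta> \<gamma>"
  have d: "0 \<le> ?d" "?d < s - r" and e: "0 \<le> ?e" "?e < t - s"
    using pos by (auto simp: xyz arc_dist_nonneg dest!: cyl_tau_pos_imp)
  have le: "arc_dist \<alpha> \<gamma> \<le> ?d + ?e"
    by (rule arc_dist_triangle)
  have "cyl_tau p x y + cyl_tau p y z \<le> ((t - r) powr p - (?d + ?e) powr p) powr (1 / p)"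
    using reverse_minkowski[OF p, of ?d "s - r" ?e "t - s"] d e by (simp add: xyz cyl_tau_def)
  also have "\<dots> \<le> ((t - r) powr p - arc_dist \<alpha> \<gamma> powr p) powr (1 / p)"
    using p d e le by (intro powr_mono2 diff_left_mono) (auto simp: arc_dist_nonneg powr_mono2)
  also have "\<dots> = cyl_tau p x z"
    using d e le by (simp add: xyz cyl_tau_def)
  finally show ?thesis .
qed

text \<open>
  The next three lemmas compare the separation with the elapsed time.  They let a vertical line
  through one of two points tell the two apart by its end point on a boundary circle.
\<close>

lemma cyl_tau_same_angle:
  assumes "1 \<le> p" "s \<le> t"
  shows "cyl_tau p (s, \<alpha>) (t, \<alpha>) = t - s"
  using assms by (simp add: cyl_tau_def powr_powr)

lemma cyl_tau_le_time:
  assumes "1 \<le> p" "s \<le> t"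
  shows "cyl_tau p (s, \<alpha>) (t, \<beta>) \<le> t - s"
proof (cases "arc_dist \<alpha> \<beta> \<le> t - s")
  case True
  have "((t - s) powr p - arc_dist \<alpha> \<beta> powr p) powr (1 / p) \<le> ((t - s) powr p) powr (1 / p)"
    using True assms by (intro powr_mono2) (auto simp: powr_mono2 arc_dist_nonneg)
  also have "\<dots> = t - s"
    using assms by (simp add: powr_powr)
  finally show ?thesis
    using True by (simp add: cyl_tau_def)
qed (use assms in \<open>simp add: cyl_tau_def\<close>)

lemma cyl_tau_less_time:
  assumes "1 \<le> p" "s < t" "\<alpha> \<noteq> \<beta>"
  shows "cyl_tau p (s, \<alpha>) (t, \<beta>) < t - s"
proof (cases "arc_dist \<alpha> \<beta> \<le> t - s")
  case True
  have "0 < arc_dist \<alpha> \<beta>"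
    using assms arc_dist_nonneg[of \<alpha> \<beta>] arc_dist_eq_0_iff[of \<alpha> \<beta>] by linarith
  then have "((t - s) powr p - arc_dist \<alpha> \<beta> powr p) powr (1 / p) < ((t - s) powr p) powr (1 / p)"
    using True assms by (intro powr_less_mono2) (auto simp: powr_mono2)
  also have "\<dots> = t - s"
    using assms by (simp add: powr_powr)
  finally show ?thesis
    using True by (simp add: cyl_tau_def)
qed (use assms in \<open>simp add: cyl_tau_def\<close>)

lemma cyl_tau_distinguishes:
  assumes p: "1 \<le> p" and x: "x \<in> cyl" and y: "y \<in> cyl" and "x \<noteq> y"
  shows "\<exists>z\<in>cyl. cyl_tau p x z \<noteq> cyl_tau p y z \<or> cyl_tau p z x \<noteq> cyl_tau p z y"
proof -
  \<comment> \<open>Points at different times are told apart by the top circle, and so are points at the same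
    time, unless that time is \<open>1\<close>; then the bottom circle serves.\<close>
  obtain s \<alpha> t \<beta> where xy: "x = (s, \<alpha>)" "y = (t, \<beta>)"
    by (cases x, cases y)
  have st: "0 \<le> s" "s \<le> 1" "0 \<le> t" "t \<le> 1"
    using x y by (auto simp: xy cyl_def)
  have cyl: "(1, \<gamma>) \<in> cyl" "(0, \<gamma>) \<in> cyl" for \<gamma>
    by (auto simp: cyl_def)
  consider "s < t" | "t < s" | "s = t" "s < 1" "\<alpha> \<noteq> \<beta>" | "s = t" "0 < s" "\<alpha> \<noteq> \<beta>"
    using \<open>x \<noteq> y\<close> xy by fastforce
  then show ?thesis
  proof cases
    case 1
    then have "cyl_tau p x (1, \<alpha>) \<noteq> cyl_tau p y (1, \<alpha>)"
      using cyl_tau_same_angle[OF p, of s 1 \<alpha>] cyl_tau_le_time[OF p, of t 1 \<beta> \<alpha>] st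
      by (simp add: xy)
    then show ?thesis
      using cyl by blast
  next
    case 2
    then have "cyl_tau p x (1, \<beta>) \<noteq> cyl_tau p y (1, \<beta>)"
      using cyl_tau_same_angle[OF p, of t 1 \<beta>] cyl_tau_le_time[OF p, of s 1 \<alpha> \<beta>] st
      by (simp add: xy)
    then show ?thesis
      using cyl by blast
  next
    case 3
    then have "cyl_tau p x (1, \<alpha>) \<noteq> cyl_tau p y (1, \<alpha>)"
      using cyl_tau_same_angle[OF p, of s 1 \<alpha>] cyl_tau_less_time[OF p, of t 1 \<beta> \<alpha>] st
      by (auto simp: xy)
    then show ?thesis
      using cyl by blast
  next
    case 4
    then have "cyl_tau p (0, \<alpha>) x \<noteq> cyl_tau p (0, \<alpha>) y"
      using cyl_tau_same_angle[OF p, of 0 s \<alpha>] cyl_tau_less_time[OF p, of 0 t \<alpha> \<beta>] st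
      by (auto simp: xy)
    then show ?thesis
      using cyl by blast
  qed
qed

text \<open>
  A form without case distinction, in which continuity is visible.  The inner maximum keeps the
  base of the power nonnegative; the outer one takes over the case of points that are not
  causally related.
\<close>

lemma cyl_tau_eq_max:
  assumes "1 \<le> p"
  shows "cyl_tau p (s, \<alpha>) (t, \<beta>)
       = (max 0 (max 0 (t - s) powr p - arc_dist \<alpha> \<beta> powr p)) powr (1 / p)"
proof (cases "arc_dist \<alpha> \<beta> \<le> t - s")
  case True
  moreover have "arc_dist \<alpha> \<beta> powr p \<le> (t - s) powr p"
    using True assms by (intro powr_mono2) (auto simp: arc_dist_nonneg)
  moreover have "0 \<le> t - s"
    using True arc_dist_nonneg[of \<alpha> \<beta>] by linarith
  ultimately show ?thesis
    by (simp add: cyl_tau_def max_def)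
next
  case False
  then have "max 0 (t - s) powr p \<le> arc_dist \<alpha> \<beta> powr p"
    using assms arc_dist_nonneg[of \<alpha> \<beta>] by (intro powr_mono2) auto
  then show ?thesis
    using False by (simp add: cyl_tau_def)
qed

definition cyl_topology :: "(real \<times> circle) topology" where
  "cyl_topology = prod_topology (top_of_set {0..1}) circle.mtopology"

lemma topspace_cyl_topology: "topspace cyl_topology = cyl"
  by (simp add: cyl_topology_def cyl_def)

lemma compact_space_cyl_topology: "compact_space cyl_topology"
  by (simp add: cyl_topology_def compact_space_prod_topology compact_space_circle
      compact_space_subtopology)

lemma continuous_map_cyl_tau:
  assumes p: "1 \<le> p"
  shows "continuous_map (prod_topology cyl_topology cyl_topology) euclideanreal
           (\<lambda>(x, y). cyl_tau p x y)"
proof -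
  let ?P = "prod_topology cyl_topology cyl_topology"
  have fst_x: "continuous_map ?P cyl_topology fst" and snd_y: "continuous_map ?P cyl_topology snd"
    by (rule continuous_map_fst continuous_map_snd)+
  have time: "continuous_map cyl_topology euclideanreal fst"
    unfolding cyl_topology_def
    using continuous_map_fst[of "top_of_set {0..1::real}" circle.mtopology]
    by (rule continuous_map_into_fulltopology)
  have angle: "continuous_map cyl_topology circle.mtopology snd"
    unfolding cyl_topology_def by (rule continuous_map_snd)
  have gap: "continuous_map ?P euclideanreal (\<lambda>q. fst (snd q) - fst (fst q))"
    using continuous_map_compose[OF fst_x time] continuous_map_compose[OF snd_y time]
    by (intro continuous_map_diff) (simp_all add: o_def)
  have "continuous_map ?P (prod_topology circle.mtopology circle.mtopology)
          (\<lambda>q. (snd (fst q), snd (snd q)))"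
    using continuous_map_compose[OF fst_x angle] continuous_map_compose[OF snd_y angle]
    by (simp add: continuous_map_pairwise o_def)
  from continuous_map_compose[OF this continuous_map_arc_dist]
  have dist: "continuous_map ?P euclideanreal (\<lambda>q. arc_dist (snd (fst q)) (snd (snd q)))"
    by (simp add: o_def)
  \<comment> \<open>The absolute value, harmless on distances, makes \<open>F\<close> continuous on the whole plane.\<close>
  define F where "F = (\<lambda>(u, d). (max 0 (max 0 u powr p - \<bar>d\<bar> powr p)) powr (1 / p) :: real)"
  have "continuous_on UNIV F"
    unfolding F_def case_prod_beta
    using p by (intro continuous_on_powr' continuous_intros) auto
  then have F: "continuous_map (prod_topology euclideanreal euclideanreal) euclideanreal F"
    by (simp add: euclidean_product_topology)
  have "continuous_map ?P (prod_topology euclideanreal euclideanreal)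
          (\<lambda>q. (fst (snd q) - fst (fst q), arc_dist (snd (fst q)) (snd (snd q))))"
    unfolding continuous_map_paired using gap dist by blast
  from continuous_map_compose[OF this F]
  have "continuous_map ?P euclideanreal
          (\<lambda>q. F (fst (snd q) - fst (fst q), arc_dist (snd (fst q)) (snd (snd q))))"
    by (simp add: o_def)
  also have "(\<lambda>q. F (fst (snd q) - fst (fst q), arc_dist (snd (fst q)) (snd (snd q))))
           = (\<lambda>(x, y). cyl_tau p x y)"
    using arc_dist_nonneg by (auto simp: fun_eq_iff F_def cyl_tau_eq_max[OF p])
  finally show ?thesis .
qed

proposition bounded_lorentzian_metric_space_cyl_tau:
  assumes p: "1 \<le> p"
  shows "bounded_lorentzian_metric_space cyl (cyl_tau p)"
proof -
  let ?P = "prod_topology cyl_topology cyl_topology"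
  have "compactin ?P {(x, y) \<in> cyl \<times> cyl. \<epsilon> \<le> cyl_tau p x y}" for \<epsilon>
  proof (rule closedin_compact_space)
    show "compact_space ?P"
      by (simp add: compact_space_prod_topology compact_space_cyl_topology)
    have "closedin ?P {q \<in> topspace ?P. (case q of (x, y) \<Rightarrow> cyl_tau p x y) \<in> {\<epsilon>..}}"
      by (rule closedin_continuous_map_preimage[OF continuous_map_cyl_tau[OF p]]) simp
    also have "{q \<in> topspace ?P. (case q of (x, y) \<Rightarrow> cyl_tau p x y) \<in> {\<epsilon>..}}
             = {(x, y) \<in> cyl \<times> cyl. \<epsilon> \<le> cyl_tau p x y}"
      by (auto simp: topspace_cyl_topology)
    finally show "closedin ?P {(x, y) \<in> cyl \<times> cyl. \<epsilon> \<le> cyl_tau p x y}" .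
  qed
  then show ?thesis
    unfolding bounded_lorentzian_metric_space_def
    using cyl_tau_nonneg cyl_tau_reverse_triangle[OF p] cyl_tau_distinguishes[OF p]
      continuous_map_cyl_tau[OF p] topspace_cyl_topology
    by blast
qed

section \<open>The cylinder with infinite exponent\<close>

lemma cyl_tau_inf_pos_iff: "0 < cyl_tau_inf (s, \<alpha>) (t, \<beta>) \<longleftrightarrow> arc_dist \<alpha> \<beta> < t - s"
proof -
  have "0 < t - s" if "arc_dist \<alpha> \<beta> < t - s"
    using that arc_dist_nonneg[of \<alpha> \<beta>] by linarith
  then show ?thesis
    by (auto simp: cyl_tau_inf_def)
qed

text \<open>On the cylinder the elapsed time is at most \<open>1\<close>, so separation \<open>1\<close> forces it to be full.\<close>

lemma cyl_tau_inf_ge_1_iff: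
  assumes "(s, \<alpha>) \<in> cyl" "(t, \<beta>) \<in> cyl"
  shows "1 \<le> cyl_tau_inf (s, \<alpha>) (t, \<beta>) \<longleftrightarrow> s = 0 \<and> t = 1 \<and> arc_dist \<alpha> \<beta> < 1"
  using assms by (auto simp: cyl_tau_inf_def cyl_def)

lemma openin_chronological_past:
  assumes "continuous_map (prod_topology T T) euclideanreal (\<lambda>(x, y). \<tau> x y)" "w \<in> topspace T"
  shows "openin T {x \<in> topspace T. 0 < \<tau> x w}"
proof -
  have "continuous_map T (prod_topology T T) (\<lambda>x. (x, w))"
    using assms(2) by (simp add: continuous_map_pairwise o_def)
  from continuous_map_compose[OF this assms(1)]
  have "continuous_map T euclideanreal (\<lambda>x. \<tau> x w)"
    by (simp add: o_def)
  from openin_continuous_map_preimage[OF this, of "{0<..}"] show ?thesis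
    by simp
qed

lemma openin_chronological_future:
  assumes "continuous_map (prod_topology T T) euclideanreal (\<lambda>(x, y). \<tau> x y)" "w \<in> topspace T"
  shows "openin T {y \<in> topspace T. 0 < \<tau> w y}"
proof -
  have "continuous_map T (prod_topology T T) (\<lambda>y. (w, y))"
    using assms(2) by (simp add: continuous_map_pairwise o_def)
  from continuous_map_compose[OF this assms(1)]
  have "continuous_map T euclideanreal (\<lambda>y. \<tau> w y)"
    by (simp add: o_def)
  from openin_continuous_map_preimage[OF this, of "{0<..}"] show ?thesis
    by simp
qed

text \<open>
  The pairs of separation at least \<open>1\<close> have an open cover without finite subcover.  Its member
  \<open>V r\<close> consists of the pairs whose first point lies in the past of some \<open>(r, \<alpha>)\<close> and
  whose second point lies in the future of some \<open>(1 - r, \<beta>)\<close>, where \<open>\<alpha>\<close> and \<open>\<beta>\<close> are at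
  distance at most \<open>1 - 4 * r\<close>.  For a boundary pair this moves each angle by less than \<open>r\<close>, so
  that its angular distance stays below \<open>1 - 2 * r\<close>.
\<close>

proposition not_bounded_lorentzian_metric_space_cyl_tau_inf:
  "\<not> bounded_lorentzian_metric_space cyl cyl_tau_inf"
proof
  assume "bounded_lorentzian_metric_space cyl cyl_tau_inf"
  then obtain T where T: "topspace T = cyl"
    and cont: "continuous_map (prod_topology T T) euclideanreal (\<lambda>(x, y). cyl_tau_inf x y)"
    and cpt: "\<forall>\<epsilon>>0. compactin (prod_topology T T)
      {(x, y) \<in> cyl \<times> cyl. \<epsilon> \<le> cyl_tau_inf x y}"
    unfolding bounded_lorentzian_metric_space_def by (elim conjE exE) (rule that, assumption+)
  define K where "K = {(x, y) \<in> cyl \<times> cyl. 1 \<le> cyl_tau_inf x y}"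
  define I where "I r = {(\<alpha>, \<beta>). arc_dist \<alpha> \<beta> \<le> 1 - 4 * r}" for r
  define V where "V r = (\<Union>(\<alpha>, \<beta>)\<in>I r.
    {x \<in> cyl. 0 < cyl_tau_inf x (r, \<alpha>)} \<times> {y \<in> cyl. 0 < cyl_tau_inf (1 - r, \<beta>) y})" for r
  have openV: "openin (prod_topology T T) (V r)" if r: "r \<in> {0<..1}" for r
  proof -
    have "(r, \<alpha>) \<in> topspace T" "(1 - r, \<alpha>) \<in> topspace T" for \<alpha>
      using r by (auto simp: T cyl_def)
    then have "openin (prod_topology T T)
      ({x \<in> cyl. 0 < cyl_tau_inf x (r, \<alpha>)} \<times> {y \<in> cyl. 0 < cyl_tau_inf (1 - r, \<beta>) y})" for \<alpha> \<beta>
      using openin_chronological_past[OF cont, of "(r, \<alpha>)"]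
        openin_chronological_future[OF cont, of "(1 - r, \<beta>)"]
      by (simp add: openin_prod_Times_iff T)
    then show ?thesis
      unfolding V_def by (intro openin_Union) auto
  qed
  have cover: "K \<subseteq> \<Union>(V ` {0<..1})"
  proof
    fix q assume "q \<in> K"
    then obtain s \<alpha> t \<beta> where q: "q = ((s, \<alpha>), (t, \<beta>))"
      and in_cyl: "(s, \<alpha>) \<in> cyl" "(t, \<beta>) \<in> cyl" and "1 \<le> cyl_tau_inf (s, \<alpha>) (t, \<beta>)"
      by (auto simp: K_def)
    then have st: "s = 0" "t = 1" and lt: "arc_dist \<alpha> \<beta> < 1"
      by (simp_all add: cyl_tau_inf_ge_1_iff)
    have "(1 - d) / 4 \<in> {0<..1} \<and> d = 1 - 4 * ((1 - d) / 4)" if "0 \<le> d" "d < 1" for d :: real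
      using that by (simp add: field_simps)
    from this[OF arc_dist_nonneg lt] obtain r where
      r: "r \<in> {0<..1}" and dist: "arc_dist \<alpha> \<beta> = 1 - 4 * r"
      by blast
    have "(\<alpha>, \<beta>) \<in> I r"
      by (simp add: I_def dist)
    moreover have "0 < cyl_tau_inf (s, \<alpha>) (r, \<alpha>)" "0 < cyl_tau_inf (1 - r, \<beta>) (t, \<beta>)"
      using r by (simp_all add: cyl_tau_inf_pos_iff st)
    ultimately have "q \<in> V r"
      using in_cyl by (auto simp: V_def q)
    with r show "q \<in> \<Union>(V ` {0<..1})"
      by blast
  qed
  have dist_less: "arc_dist \<alpha> \<beta> < 1 - 2 * r" if "((0, \<alpha>), (1, \<beta>)) \<in> V r" for \<alpha> \<beta> r
  proof -
    obtain \<alpha>' \<beta>' where I: "arc_dist \<alpha>' \<beta>' \<le> 1 - 4 * r"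
      and "0 < cyl_tau_inf (0, \<alpha>) (r, \<alpha>')" "0 < cyl_tau_inf (1 - r, \<beta>') (1, \<beta>)"
      using \<open>((0, \<alpha>), (1, \<beta>)) \<in> V r\<close> by (auto simp: V_def I_def)
    then have "arc_dist \<alpha> \<alpha>' < r" "arc_dist \<beta>' \<beta> < r"
      by (simp_all add: cyl_tau_inf_pos_iff)
    then show ?thesis
      using I arc_dist_triangle[of \<alpha> \<beta> \<alpha>'] arc_dist_triangle[of \<alpha>' \<beta> \<beta>'] by linarith
  qed
  have "compactin (prod_topology T T) K"
    unfolding K_def using cpt[rule_format, of 1] by simp
  then obtain \<F> where \<F>: "finite \<F>" "\<F> \<subseteq> V ` {0<..1}" "K \<subseteq> \<Union>\<F>"
    using compactinD[of "prod_topology T T" K "V ` {0<..1}"] openV cover by blast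
  then obtain R where R: "finite R" "R \<subseteq> {0<..1}" "\<F> = V ` R"
    by (metis finite_subset_image)
  \<comment> \<open>Inserting \<open>1\<close> covers the case of an empty \<open>R\<close> and keeps \<open>1 - m\<close> nonnegative.\<close>
  define m where "m = Min (insert 1 R)"
  have m: "0 < m" "m \<le> 1" "\<And>r. r \<in> R \<Longrightarrow> m \<le> r"
    using R by (auto simp: m_def)
  have "arc_dist (abs_circle 0) (abs_circle (1 - m)) = 1 - m"
    using arc_dist_abs_circle[of 0 "1 - m"] m pi_gt3 by simp
  moreover from this have "((0, abs_circle 0), (1, abs_circle (1 - m))) \<in> K"
    using m by (auto simp: K_def cyl_def cyl_tau_inf_def)
  then obtain r where "r \<in> R" "((0, abs_circle 0), (1, abs_circle (1 - m))) \<in> V r"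
    using \<F> R by blast
  ultimately show False
    using dist_less m by fastforce
qed

theorem lemma3p6:
  shows "(\<forall>p::real. 1 \<le> p \<longrightarrow> bounded_lorentzian_metric_space cyl (cyl_tau p))
       \<and> \<not> bounded_lorentzian_metric_space cyl cyl_tau_inf"
  using bounded_lorentzian_metric_space_cyl_tau not_bounded_lorentzian_metric_space_cyl_tau_inf
  by blast

end
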